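(* Let $p\in(1,\infty)$ and let $A\subset\mathbb{R}^q$ be a compact convex set with $\operatorname{int}A\ne\emptyset$, contained in a ball of $\ell_p$-radius $R>0$. Then the maximum number $N_p(\operatorname{bd}A,\varepsilon)$ of $\varepsilon$-separated points (in $\|\cdot\|_p$) on $\operatorname{bd}A$ satisfies $$N_p(\operatorname{bd}A,\varepsilon)\le C_4(p,q)\cdot\left(\frac{R}{\varepsilon}\right)^{q-1},$$ where $C_4(p,q)>0$ depends only on $p$ and $q$.
   Context: $\|\cdot\|_p$ is the $\ell_p$ norm on $\mathbb{R}^q$, $\operatorname{bd}A$ is the topological boundary of $A$, and $\varepsilon>0$. Points $x_1,\dots,x_N$ are $\varepsilon$-separated if $\|x_i-x_j\|_p\ge\varepsilon$ for all $i\ne j$.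
   Formalization: For q ≥ 2 the bound is stated only for ε ≤ 2R: for larger ε a single point is vacuously ε-separated, so the maximum number is 1 while C·(R/ε)^(q−1) tends to 0 as ε grows, and the bound as written fails. *)

theory Defs
  imports "HOL-Analysis.Analysis"
begin

definition lp_norm :: "real \<Rightarrow> real ^ 'q \<Rightarrow> real" where
  "lp_norm p x = (\<Sum>i\<in>UNIV. \<bar>x $ i\<bar> powr p) powr (1 / p)"

definition lp_separated :: "real \<Rightarrow> real \<Rightarrow> nat \<Rightarrow> (nat \<Rightarrow> real ^ 'q) \<Rightarrow> bool" where
  "lp_separated p \<epsilon> N x \<longleftrightarrow>
     (\<forall>i<N. \<forall>j<N. i \<noteq> j \<longrightarrow> lp_norm p (x i - x j) \<ge> \<epsilon>)"

text \<open>
  The supremum is taken in \<^typ>\<open>enat\<close>, so the value is \<open>\<infinity>\<close> exactly when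
  there are arbitrarily large separated families; a finite value is a maximum.
\<close>

definition lp_packing_number :: "real \<Rightarrow> (real ^ 'q) set \<Rightarrow> real \<Rightarrow> enat" where
  "lp_packing_number p S \<epsilon> =
     (SUP N \<in> {N. \<exists>x. (\<forall>i<N. x i \<in> S) \<and> lp_separated p \<epsilon> N x}. enat N)"

end

theory Submission
  imports Defs
begin

text \<open>
  The nearest-point projection onto a convex body is 1-Lipschitz for the Euclidean norm, so the
  boundary of the body is no more complicated than the boundary of any cube around it, and the
  latter consists of \<open>2 q\<close> cubes of dimension \<open>q - 1\<close>.

  In detail: \<open>A\<close> lies in the cube of half-side \<open>R\<close> about \<open>c\<close>, because the maximum norm is at most
  the \<open>p\<close>-norm. Walk from each point of \<open>frontier A\<close> along an outer normal until the boundary of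
  the concentric cube of half-side \<open>2 R\<close> is reached (lemma \<open>outer_normal_ray\<close>). The start is the
  projection of the end, so Euclidean distances do not decrease
  (lemma \<open>outer_normal_translates_expand\<close>).
  As the \<open>p\<close>-norm is at most \<open>q powr (1 / p)\<close> times the Euclidean norm, an \<open>\<epsilon>\<close>-separated family on
  \<open>frontier A\<close> yields equally many points on the boundary of the big cube whose mutual Euclidean
  distances are at least a constant multiple of \<open>\<epsilon>\<close>. Cutting each facet into a grid of mesh
  proportional to \<open>\<epsilon>\<close> leaves at most one point in each cell, and there are
  \<open>O((R / \<epsilon>) ^ (q - 1))\<close> cells (lemma \<open>card_separated_on_cube_frontier\<close>). The restriction
  \<open>\<epsilon> \<le> 2 R\<close> absorbs the rounding of the number of cells per axis; for \<open>q = 1\<close> a facet is a point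
  and nothing has to be rounded.
\<close>

section \<open>Comparison of norms\<close>

lemma abs_component_le_lp_norm:
  fixes x :: "real ^ 'q"
  assumes "0 < p"
  shows "\<bar>x $ i\<bar> \<le> lp_norm p x"
proof -
  have "\<bar>x $ i\<bar> = (\<bar>x $ i\<bar> powr p) powr (1 / p)"
    using assms by (simp add: powr_powr)
  also have "\<dots> \<le> lp_norm p x"
    unfolding lp_norm_def using assms
    by (intro powr_mono2 member_le_sum) auto
  finally show ?thesis .
qed

lemma lp_norm_le_norm:
  fixes x :: "real ^ 'q"
  assumes "0 < p"
  shows "lp_norm p x \<le> real CARD('q) powr (1 / p) * norm x"
proof -
  have "(\<Sum>i\<in>UNIV. \<bar>x $ i\<bar> powr p) \<le> (\<Sum>i\<in>(UNIV::'q set). norm x powr p)"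
    using assms by (intro sum_mono powr_mono2) (auto simp: component_le_norm_cart)
  then have "lp_norm p x \<le> (real CARD('q) * norm x powr p) powr (1 / p)"
    unfolding lp_norm_def using assms by (intro powr_mono2) (auto intro: sum_nonneg)
  also have "\<dots> = real CARD('q) powr (1 / p) * norm x"
    using assms by (simp add: powr_mult powr_powr)
  finally show ?thesis .
qed

section \<open>From the boundary of a convex set to the boundary of a cube\<close>

text \<open>
  The two hypotheses say that \<open>n\<close> and \<open>n'\<close> are outer normals of the segment from \<open>y\<close> to \<open>y'\<close> at
  its endpoints. Then \<open>(y + n - (y' + n')) \<bullet> (y - y') \<ge> norm (y - y') ^ 2\<close>, and Cauchy-Schwarz
  applies.
\<close>

lemma outer_normal_translates_expand:
  fixes y y' n n' :: "'a :: real_inner"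
  assumes "n \<bullet> y' \<le> n \<bullet> y" and "n' \<bullet> y \<le> n' \<bullet> y'"
  shows "norm (y - y') \<le> norm ((y + n) - (y' + n'))"
proof -
  have "norm (y - y') * norm (y - y') \<le> ((y + n) - (y' + n')) \<bullet> (y - y')"
    using assms by (simp add: algebra_simps flip: power2_eq_square)
      (simp add: power2_norm_eq_inner algebra_simps inner_commute)
  also have "\<dots> \<le> norm ((y + n) - (y' + n')) * norm (y - y')"
    by (rule norm_cauchy_schwarz)
  finally show ?thesis
    by (cases "y = y'") auto
qed

text \<open>
  A supporting hyperplane at \<open>y\<close> supplies the direction, and the length is chosen so that the ray
  ends on \<open>frontier B\<close>. Only the displacement \<open>n\<close> is kept: it is an outer normal of \<open>A\<close> at \<open>y\<close>, so
  \<open>y\<close> is the point of \<open>A\<close> nearest to \<open>y + n\<close>.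
\<close>

lemma outer_normal_ray:
  fixes A B :: "'a :: euclidean_space set"
  assumes "convex A" "closed A" "interior A \<noteq> {}" and AB: "A \<subseteq> interior B" and "bounded B"
    and y: "y \<in> frontier A"
  obtains n where "y + n \<in> frontier B" and "\<And>w. w \<in> A \<Longrightarrow> n \<bullet> w \<le> n \<bullet> y"
proof -
  have yA: "y \<in> A"
    using y \<open>closed A\<close> frontier_subset_eq by blast
  obtain a where "a \<noteq> 0" and a: "\<And>w. w \<in> A \<Longrightarrow> a \<bullet> y \<le> a \<bullet> w"
    using supporting_hyperplane_rel_boundary[OF \<open>convex A\<close> yA] y \<open>interior A \<noteq> {}\<close>
    by (metis Diff_iff frontier_def rel_interior_nonempty_interior)
  obtain d where d: "0 < d" "y + d *\<^sub>R (- a) \<in> frontier B"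
    using ray_to_frontier[OF \<open>bounded B\<close>, of y "- a"] AB yA \<open>a \<noteq> 0\<close>
    by (metis neg_equal_0_iff_equal subsetD)
  show thesis
  proof
    show "y + d *\<^sub>R (- a) \<in> frontier B" by (fact d)
    show "(d *\<^sub>R (- a)) \<bullet> w \<le> (d *\<^sub>R (- a)) \<bullet> y" if "w \<in> A" for w
      using a[OF that] d(1) by simp
  qed
qed

section \<open>Counting separated points on the boundary of a cube\<close>

lemma frontier_cubeE:
  fixes c z :: "real ^ 'q"
  assumes "z \<in> frontier (cbox (c - vec r) (c + vec r))"
  obtains k s where "z $ k = c $ k + (if s then r else - r)"
    and "\<And>i. \<bar>z $ i - c $ i\<bar> \<le> r"
proof -
  have "z \<in> cbox (c - vec r) (c + vec r)" "z \<notin> box (c - vec r) (c + vec r)"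
    using assms by (auto simp: frontier_cbox)
  then have le: "\<bar>z $ i - c $ i\<bar> \<le> r" and ex: "\<exists>k. \<not> \<bar>z $ k - c $ k\<bar> < r" for i
    by (auto simp: mem_box_cart abs_le_iff abs_less_iff algebra_simps)
  then obtain k where "\<bar>z $ k - c $ k\<bar> = r"
    by (meson order_le_less)
  then have "z $ k = c $ k + (if z $ k \<ge> c $ k then r else - r)"
    by auto
  with le show thesis by (rule that[rotated])
qed

text \<open>
  A cell is named by a facet, that is a coordinate \<open>k\<close> and a side, and by grid indices for the
  coordinates other than \<open>k\<close>. Two points in one cell agree in coordinate \<open>k\<close> and differ by less
  than \<open>\<delta>\<close> in the others, so even their distance in the sum norm is less than \<open>q \<delta>\<close>.
\<close>

lemma card_separated_on_cube_frontier:
  fixes z :: "nat \<Rightarrow> real ^ 'q"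
  assumes "0 < \<delta>" "0 \<le> r"
    and z: "\<And>j. j < N \<Longrightarrow> z j \<in> frontier (cbox (c - vec r) (c + vec r))"
    and sep: "\<And>i j. i < N \<Longrightarrow> j < N \<Longrightarrow> i \<noteq> j \<Longrightarrow> real CARD('q) * \<delta> \<le> norm (z i - z j)"
  shows "N \<le> 2 * CARD('q) * Suc (nat \<lfloor>2 * r / \<delta>\<rfloor>) ^ (CARD('q) - 1)"
proof -
  define m where "m = \<lfloor>2 * r / \<delta>\<rfloor>"
  have "0 \<le> m"
    using assms(1,2) by (simp add: m_def)
  define grid where "grid w i = \<lfloor>(w $ i - c $ i + r) / \<delta>\<rfloor>" for w :: "real ^ 'q" and i
  define cells where
    "cells = (SIGMA ks : (UNIV :: ('q \<times> bool) set). PiE (- {fst ks}) (\<lambda>_. {0..m}))"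
  have "\<exists>k s. z j $ k = c $ k + (if s then r else - r) \<and> (\<forall>i. \<bar>z j $ i - c $ i\<bar> \<le> r)"
    if "j < N" for j
    using frontier_cubeE[OF z[OF that]] by metis
  then obtain k s where
      face: "\<And>j. j < N \<Longrightarrow> z j $ k j = c $ k j + (if s j then r else - r)"
      and inside: "\<And>j i. j < N \<Longrightarrow> \<bar>z j $ i - c $ i\<bar> \<le> r"
    by metis
  define cell where "cell j = ((k j, s j), restrict (grid (z j)) (- {k j}))" for j
  have grid_range: "grid (z j) i \<in> {0..m}" if "j < N" for i j
  proof -
    have "0 \<le> z j $ i - c $ i + r" "z j $ i - c $ i + r \<le> 2 * r"
      using inside[OF that, of i] by auto
    then show ?thesis
      using \<open>0 < \<delta>\<close> by (auto simp: grid_def m_def intro!: floor_mono divide_right_mono)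
  qed
  have "inj_on cell {..<N}"
  proof (rule inj_onI, rule ccontr)
    fix i j assume ij: "i \<in> {..<N}" "j \<in> {..<N}" "cell i = cell j" "i \<noteq> j"
    have close: "\<bar>(z i - z j) $ l\<bar> < \<delta>" for l
    proof (cases "l = k i")
      case True
      then show ?thesis
        using ij face[of i] face[of j] \<open>0 < \<delta>\<close> by (simp add: cell_def)
    next
      case False
      then have "grid (z i) l = grid (z j) l"
        using ij(3) unfolding cell_def by (metis ComplI Pair_inject restrict_apply singletonD)
      then have "\<bar>(z i $ l - c $ l + r) / \<delta> - (z j $ l - c $ l + r) / \<delta>\<bar> < 1"
        unfolding grid_def by linarith
      then have "\<bar>z i $ l - z j $ l\<bar> / \<delta> < 1"
        using \<open>0 < \<delta>\<close> by (simp flip: diff_divide_distrib)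
      then show ?thesis
        using \<open>0 < \<delta>\<close> by simp
    qed
    have "norm (z i - z j) \<le> (\<Sum>l\<in>UNIV. \<bar>(z i - z j) $ l\<bar>)"
      by (rule norm_le_l1_cart)
    also have "\<dots> < (\<Sum>l\<in>(UNIV :: 'q set). \<delta>)"
      using close by (intro sum_strict_mono) auto
    also have "\<dots> \<le> norm (z i - z j)"
      using sep ij by simp
    finally show False by simp
  qed
  moreover have "cell ` {..<N} \<subseteq> cells"
  proof (rule image_subsetI)
    fix j assume "j \<in> {..<N}"
    then have "grid (z j) i \<in> {0..m}" for i
      by (intro grid_range) simp
    then show "cell j \<in> cells"
      by (simp add: cell_def cells_def restrict_PiE_iff del: restrict_apply atLeastAtMost_iff)
  qed
  moreover have "finite cells"
    unfolding cells_def by (intro finite_SigmaI finite_PiE) auto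
  ultimately have "N \<le> card cells"
    using card_inj_on_le by fastforce
  also have "card cells = (\<Sum>ks\<in>(UNIV :: ('q \<times> bool) set). Suc (nat m) ^ (CARD('q) - 1))"
    using \<open>0 \<le> m\<close>
    by (simp add: cells_def card_SigmaI finite_PiE card_PiE Compl_eq_Diff_UNIV card_Diff_singleton nat_add_distrib)
  also have "\<dots> = 2 * CARD('q) * Suc (nat m) ^ (CARD('q) - 1)"
    by (simp add: card_prod mult.commute)
  finally show ?thesis
    by (simp add: m_def)
qed

section \<open>The packing bound\<close>

lemma card_lp_separated_frontier_le:
  fixes A :: "(real ^ 'q) set"
  assumes "0 < p" "compact A" "convex A" "interior A \<noteq> {}" "0 < R" "0 < \<epsilon>"
    and ball: "\<And>x. x \<in> A \<Longrightarrow> lp_norm p (x - c) \<le> R"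
    and y: "\<And>j. j < N \<Longrightarrow> y j \<in> frontier A" and sep: "lp_separated p \<epsilon> N y"
  shows "N \<le> 2 * CARD('q)
    * Suc (nat \<lfloor>4 * real CARD('q) * real CARD('q) powr (1 / p) * (R / \<epsilon>)\<rfloor>) ^ (CARD('q) - 1)"
proof -
  define K where "K = real CARD('q) powr (1 / p)"
  \<comment> \<open>\<open>q \<delta>\<close> is the Euclidean separation \<open>\<epsilon> / K\<close> that \<open>\<epsilon>\<close>-separated points are sure to have.\<close>
  define \<delta> where "\<delta> = \<epsilon> / (K * real CARD('q))"
  \<comment> \<open>Half-side \<open>2 R\<close> instead of \<open>R\<close> puts \<open>A\<close> in the interior, where rays to the frontier exist.\<close>
  define B where "B = cbox (c - vec (2 * R)) (c + vec (2 * R))"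
  have "0 < K"
    by (simp add: K_def)
  then have "0 < \<delta>"
    using \<open>0 < \<epsilon>\<close> by (simp add: \<delta>_def)
  have AB: "A \<subseteq> interior B"
  proof
    fix x assume "x \<in> A"
    then have "\<bar>(x - c) $ i\<bar> < 2 * R" for i
      using abs_component_le_lp_norm[OF \<open>0 < p\<close>, of "x - c" i] ball[of x] \<open>0 < R\<close> by linarith
    then show "x \<in> interior B"
      by (auto simp: B_def interior_cbox mem_box_cart abs_less_iff algebra_simps)
  qed
  have "closed A" "bounded B"
    using \<open>compact A\<close> by (auto simp: compact_imp_closed B_def)
  have "\<exists>n. y j + n \<in> frontier B \<and> (\<forall>w\<in>A. n \<bullet> w \<le> n \<bullet> y j)" if "j < N" for j
    using outer_normal_ray[OF \<open>convex A\<close> \<open>closed A\<close> \<open>interior A \<noteq> {}\<close> AB \<open>bounded B\<close> y[OF that]] by metis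
  then obtain n where
      n: "\<And>j. j < N \<Longrightarrow> y j + n j \<in> frontier B"
         "\<And>j w. j < N \<Longrightarrow> w \<in> A \<Longrightarrow> n j \<bullet> w \<le> n j \<bullet> y j"
    by metis
  have "real CARD('q) * \<delta> \<le> norm ((y i + n i) - (y j + n j))"
    if "i < N" "j < N" "i \<noteq> j" for i j
  proof -
    have "y i \<in> A" "y j \<in> A"
      using y that \<open>closed A\<close> frontier_subset_eq by blast+
    then have "norm (y i - y j) \<le> norm ((y i + n i) - (y j + n j))"
      using n(2) that by (intro outer_normal_translates_expand) auto
    moreover have "\<epsilon> \<le> K * norm (y i - y j)"
      using sep that lp_norm_le_norm[OF \<open>0 < p\<close>, of "y i - y j"]
      unfolding lp_separated_def K_def by force
    then have "real CARD('q) * \<delta> \<le> norm (y i - y j)"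
      using \<open>0 < K\<close> by (simp add: \<delta>_def field_simps)
    ultimately show ?thesis by linarith
  qed
  then have "N \<le> 2 * CARD('q) * Suc (nat \<lfloor>2 * (2 * R) / \<delta>\<rfloor>) ^ (CARD('q) - 1)"
    using n(1) \<open>0 < \<delta>\<close> \<open>0 < R\<close> unfolding B_def
    by (intro card_separated_on_cube_frontier[where z = "\<lambda>j. y j + n j"]) auto
  also have "2 * (2 * R) / \<delta> = 4 * real CARD('q) * K * (R / \<epsilon>)"
    by (simp add: \<delta>_def)
  finally show ?thesis
    by (simp add: K_def)
qed

theorem lemma10:
  fixes p :: real
  assumes "1 < p"
  shows "\<exists>C>0. \<forall>(A :: (real ^ 'q) set) R \<epsilon>.
    compact A \<longrightarrow> convex A \<longrightarrow> interior A \<noteq> {} \<longrightarrow>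
    R > 0 \<longrightarrow> (\<exists>c. \<forall>x\<in>A. lp_norm p (x - c) \<le> R) \<longrightarrow>
    \<epsilon> > 0 \<longrightarrow> (\<epsilon> \<le> 2 * R \<or> CARD('q) = 1) \<longrightarrow>
    ereal_of_enat (lp_packing_number p (frontier A) \<epsilon>)
      \<le> ereal (C * (R / \<epsilon>) ^ (CARD('q) - 1))"
proof -
  define D where "D = 4 * real CARD('q) * real CARD('q) powr (1 / p)"
  define C where "C = 2 * real CARD('q) * (D + 2) ^ (CARD('q) - 1)"
  have "0 < D"
    by (simp add: D_def)
  then have "0 < C"
    by (simp add: C_def)
  moreover have "ereal_of_enat (lp_packing_number p (frontier A) \<epsilon>)
      \<le> ereal (C * (R / \<epsilon>) ^ (CARD('q) - 1))"
    if "compact A" "convex A" "interior A \<noteq> {}" "0 < R" "\<forall>x\<in>A. lp_norm p (x - c) \<le> R" "0 < \<epsilon>"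
      and small: "\<epsilon> \<le> 2 * R \<or> CARD('q) = 1"
    for A :: "(real ^ 'q) set" and R \<epsilon> c
  proof -
    define m where "m = nat \<lfloor>D * (R / \<epsilon>)\<rfloor>"
    define b where "b = 2 * CARD('q) * Suc m ^ (CARD('q) - 1)"
    have "lp_packing_number p (frontier A) \<epsilon> \<le> enat b"
      unfolding lp_packing_number_def
    proof (rule SUP_least)
      fix N
      assume "N \<in> {N. \<exists>x. (\<forall>i<N. x i \<in> frontier A) \<and> lp_separated p \<epsilon> N x}"
      then obtain y where "\<And>j. j < N \<Longrightarrow> y j \<in> frontier A" "lp_separated p \<epsilon> N y"
        by auto
      then have "N \<le> b"
        unfolding b_def m_def D_def using that assms
        by (intro card_lp_separated_frontier_le[where A = A and c = c and y = y]) auto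
      then show "enat N \<le> enat b"
        by simp
    qed
    then have "ereal_of_enat (lp_packing_number p (frontier A) \<epsilon>) \<le> ereal (real b)"
      by (metis ereal_of_enat_le_iff ereal_of_enat_simps(1))
    moreover have "real (Suc m) ^ (CARD('q) - 1) \<le> ((D + 2) * (R / \<epsilon>)) ^ (CARD('q) - 1)"
    proof (cases "CARD('q) = 1")
      case False
      with small have "1 \<le> 2 * (R / \<epsilon>)"
        using \<open>0 < \<epsilon>\<close> by (simp add: field_simps)
      moreover have "0 \<le> D * (R / \<epsilon>)"
        using \<open>0 < D\<close> \<open>0 < R\<close> \<open>0 < \<epsilon>\<close> by simp
      then have "real m \<le> D * (R / \<epsilon>)"
        unfolding m_def by (simp add: of_nat_nat)
      ultimately have "real (Suc m) \<le> (D + 2) * (R / \<epsilon>)"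
        unfolding distrib_right by simp
      then show ?thesis
        by (intro power_mono) auto
    qed simp
    then have "2 * real CARD('q) * real (Suc m) ^ (CARD('q) - 1)
        \<le> 2 * real CARD('q) * ((D + 2) * (R / \<epsilon>)) ^ (CARD('q) - 1)"
      by (intro mult_left_mono) auto
    then have "real b \<le> C * (R / \<epsilon>) ^ (CARD('q) - 1)"
      by (simp only: b_def C_def power_mult_distrib mult.assoc of_nat_mult of_nat_power of_nat_numeral)
    ultimately show ?thesis
      using order_trans ereal_less_eq(3) by blast
  qed
  ultimately show ?thesis
    by blast
qed

end
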